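(* Let $\lambda\ge 0$ be some prespecified constant. If $(\bar{\mathbf{x}}_T-\bar{\mathbf{x}}_C)\,|\,\mathbf{x}\sim\mathcal{N}(0,\mathbf{\Sigma})$, then $$M_\lambda\,|\,\mathbf{x}\;\sim\;\sum_{j=1}^K \frac{\lambda_j}{\lambda_j+\lambda}\, Z_j^2,$$ where $Z_1,\dots,Z_K$ are i.i.d. $\mathcal{N}(0,1)$ and $\lambda_1\ge\dots\ge\lambda_K>0$ are the eigenvalues of $\mathbf{\Sigma}$.
   Context: $\mathbf{x}$ is the real $N\times K$ matrix of $K$ covariates measured on $N$ experimental units. In a completely randomized experiment, a fixed number $N_T$ of units is assigned to treatment and $N_C=N-N_T$ to control; $W_i=1$ if unit $i$ is assigned to treatment and $W_i=0$ otherwise, and $\mathbf{W}=(W_1,\dots,W_N)^\top$ is the random assignment vector. The covariate mean vectors in treatment and control are $\bar{\mathbf{x}}_T=N_T^{-1}\mathbf{x}^\top\mathbf{W}$ and $\bar{\mathbf{x}}_C=N_C^{-1}\mathbf{x}^\top(\mathbf{1}_N-\mathbf{W})$, where $\mathbf{1}_N$ is the all-ones column vector. $\mathbf{\Sigma}=\mathrm{Cov}(\bar{\mathbf{x}}_T-\bar{\mathbf{x}}_C\,|\,\mathbf{x})=\frac{N}{N_TN_C}S^2_{\mathbf{x}}$ is the covariance matrix of the covariate mean differences under complete randomization, where $S^2_{\mathbf{x}}=(N-1)^{-1}(\mathbf{x}-\mathbf{1}_N\bar{\mathbf{x}}_N)^\top(\mathbf{x}-\mathbf{1}_N\bar{\mathbf{x}}_N)$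 and $\bar{\mathbf{x}}_N=N^{-1}\mathbf{1}_N^\top\mathbf{x}$. $\mathbf{\Sigma}$ is assumed positive definite. The ridge Mahalanobis distance is $M_\lambda=(\bar{\mathbf{x}}_T-\bar{\mathbf{x}}_C)^\top(\mathbf{\Sigma}+\lambda\,\mathbf{I}_K)^{-1}(\bar{\mathbf{x}}_T-\bar{\mathbf{x}}_C)$, with $\mathbf{I}_K$ the $K\times K$ identity matrix. *)

theory Defs
  imports
    "HOL-Probability.Probability"
    "HOL-Computational_Algebra.Polynomial"
    "HOL-Combinatorics.Transposition"
begin

text \<open>
  The covariate matrix \<open>x\<close> has type \<open>real^'k^'n\<close>: its rows are indexed by the units (type \<open>'n\<close>)
  and its columns by the covariates (type \<open>'k\<close>).  Everything is conditional on \<open>x\<close>, so \<open>x\<close> is a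
  fixed matrix.  The number \<open>nT\<close> of treated units is meant to satisfy \<open>0 < nT < CARD('n)\<close>.

  Assignment vectors \<open>W\<close> have real entries that are not restricted to \<open>0\<close> and \<open>1\<close>.  A mean
  difference that is exactly normal with positive definite covariance cannot take finitely many
  values, so with the restriction the assumption of exact normality would be unsatisfiable.
\<close>

definition mean_treated :: "real^'k^'n \<Rightarrow> nat \<Rightarrow> real^'n \<Rightarrow> real^'k" where
  "mean_treated x nT W = (1 / real nT) *\<^sub>R (transpose x *v W)"

definition mean_control :: "real^'k^'n \<Rightarrow> nat \<Rightarrow> real^'n \<Rightarrow> real^'k" where
  "mean_control x nT W = (1 / (real CARD('n) - real nT)) *\<^sub>R (transpose x *v (1 - W))"

definition mean_diff :: "real^'k^'n \<Rightarrow> nat \<Rightarrow> real^'n \<Rightarrow> real^'k" where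
  "mean_diff x nT W = mean_treated x nT W - mean_control x nT W"

definition col_mean :: "real^'k^'n \<Rightarrow> real^'k" where
  "col_mean x = (1 / real CARD('n)) *\<^sub>R (1 v* x)"

definition centered :: "real^'k^'n \<Rightarrow> real^'k^'n" where
  "centered x = (\<chi> i j. x $ i $ j - col_mean x $ j)"

definition sample_cov :: "real^'k^'n \<Rightarrow> real^'k^'k" where
  "sample_cov x = (1 / (real CARD('n) - 1)) *\<^sub>R (transpose (centered x) ** centered x)"

definition Sigma_mat :: "real^'k^'n \<Rightarrow> nat \<Rightarrow> real^'k^'k" where
  "Sigma_mat x nT =
     (real CARD('n) / (real nT * (real CARD('n) - real nT))) *\<^sub>R sample_cov x"

definition ridge_mahalanobis :: "real^'k^'n \<Rightarrow> nat \<Rightarrow> real \<Rightarrow> real^'n \<Rightarrow> real" where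
  "ridge_mahalanobis x nT l W =
     mean_diff x nT W \<bullet> (matrix_inv (Sigma_mat x nT + l *\<^sub>R mat 1) *v mean_diff x nT W)"

definition positive_definite :: "real^'k^'k \<Rightarrow> bool" where
  "positive_definite A \<longleftrightarrow> transpose A = A \<and> (\<forall>v. v \<noteq> 0 \<longrightarrow> v \<bullet> (A *v v) > 0)"

text \<open>Density of the normal law on \<open>real^'k\<close> with mean \<open>\<mu>\<close> and (positive definite) covariance \<open>S\<close>.\<close>

definition mv_normal_density :: "real^'k \<Rightarrow> real^'k^'k \<Rightarrow> real^'k \<Rightarrow> real" where
  "mv_normal_density \<mu> S v =
     1 / sqrt ((2 * pi) ^ CARD('k) * det S) * exp (- ((v - \<mu>) \<bullet> (matrix_inv S *v (v - \<mu>))) / 2)"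

definition charpoly :: "real^'k^'k \<Rightarrow> real poly" where
  "charpoly A = det (\<chi> i j. (if i = j then [:0, 1:] else 0) - [:A $ i $ j:])"

text \<open>
  The real eigenvalues in decreasing order, repeated according to their algebraic multiplicity;
  list positions start at \<open>0\<close>, so \<open>eigenvalues A ! j\<close> is the eigenvalue with index \<open>j + 1\<close>.
\<close>

definition eigenvalues :: "real^'k^'k \<Rightarrow> real list" where
  "eigenvalues A = rev (sorted_list_of_multiset (proots (charpoly A)))"

text \<open>
  Complete randomization: the treated set is uniform among the sets of \<open>nT\<close> units.  The lemma
  below shows that \<open>Sigma_mat\<close> is the covariance matrix of the mean difference under this law.
\<close>

definition complete_randomization :: "nat \<Rightarrow> (real^'n) pmf" where
  "complete_randomization nT =
     map_pmf (\<lambda>T. \<chi> i. of_bool (i \<in> T)) (pmf_of_set {T :: 'n set. card T = nT})"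

lemma sum_centered: "(\<Sum>i\<in>UNIV. centered x $ i $ j) = 0"
  by (simp add: centered_def col_mean_def vector_matrix_mult_def sum_subtractf)

lemma mean_diff_centered:
  fixes x :: "real^'k^'n" and T :: "'n set"
  assumes "0 < nT" "nT < CARD('n)" "card T = nT"
  shows "mean_diff x nT (\<chi> i. of_bool (i \<in> T)) $ j =
    real CARD('n) / (real nT * (real CARD('n) - real nT)) *
      (\<Sum>i\<in>UNIV. centered x $ i $ j * of_bool (i \<in> T))"
proof -
  let ?a = "real nT" and ?b = "real CARD('n) - real nT"
  let ?w = "\<lambda>i. of_bool (i \<in> T) :: real"
  let ?m = "col_mean x $ j"
  have ab: "?a > 0" "?b > 0" using assms by auto
  have sw: "(\<Sum>i\<in>UNIV. ?w i) = ?a" using assms by simp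
  have x: "x $ i $ j = centered x $ i $ j + ?m" for i by (simp add: centered_def)
  let ?S = "\<Sum>i\<in>UNIV. centered x $ i $ j * ?w i"
  have s1: "(\<Sum>i\<in>UNIV. x $ i $ j * ?w i) = ?S + ?m * ?a"
    unfolding x sw[symmetric] by (simp add: distrib_right sum.distrib sum_distrib_left)
  have s2: "(\<Sum>i\<in>UNIV. x $ i $ j * (1 - ?w i)) = ?m * ?b - ?S"
  proof -
    have "(\<Sum>i\<in>UNIV. x $ i $ j * (1 - ?w i)) =
        (\<Sum>i\<in>UNIV. x $ i $ j) - (\<Sum>i\<in>UNIV. x $ i $ j * ?w i)"
      by (simp only: right_diff_distrib sum_subtractf mult_1_right)
    also have "(\<Sum>i\<in>UNIV. x $ i $ j) = ?m * real CARD('n)"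
      unfolding x by (simp add: sum.distrib sum_centered)
    finally show ?thesis unfolding s1 by (simp add: algebra_simps)
  qed
  have "mean_diff x nT (\<chi> i. ?w i) $ j = (?S + ?m * ?a) / ?a - (?m * ?b - ?S) / ?b"
    unfolding s1[symmetric] s2[symmetric]
    by (simp add: mean_diff_def mean_treated_def mean_control_def matrix_vector_mult_def
        transpose_def)
  also have "\<dots> = ?S / ?a + ?S / ?b" using ab by (simp add: field_simps)
  also have "\<dots> = real CARD('n) / (?a * ?b) * ?S" using ab by (simp add: field_simps)
  finally show ?thesis .
qed

lemma Sigma_mat_eq_covariance:
  fixes x :: "real^'k^'n"
  assumes nT: "0 < nT" "nT < CARD('n)"
  defines "E \<equiv> measure_pmf.expectation (complete_randomization nT :: (real^'n) pmf)"
  shows "Sigma_mat x nT $ j $ k =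
    E (\<lambda>W. (mean_diff x nT W $ j - E (\<lambda>W. mean_diff x nT W $ j)) *
           (mean_diff x nT W $ k - E (\<lambda>W. mean_diff x nT W $ k)))"
proof -
  define A where "A = {T :: 'n set. card T = nT}"
  define e :: "('n set \<Rightarrow> real) \<Rightarrow> real" where "e = (\<lambda>f. (\<Sum>T\<in>A. f T) / card A)"
  have fin: "finite A" by simp
  have ne: "A \<noteq> {}"
    using nT obtain_subset_with_card_n[of nT "UNIV :: 'n set"] by (force simp: A_def)
  have E: "E f = e (\<lambda>T. f (\<chi> i. of_bool (i \<in> T)))" for f :: "real^'n \<Rightarrow> real"
    unfolding E_def complete_randomization_def e_def A_def[symmetric]
    by (simp add: integral_pmf_of_set[OF ne fin])
  have e_cong: "e f = e g" if "\<And>T. card T = nT \<Longrightarrow> f T = g T" for f g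
    unfolding e_def A_def using that by simp
  have e_sum: "e (\<lambda>T. \<Sum>i\<in>I. f i T) = (\<Sum>i\<in>I. e (f i))" for f and I :: "'i set"
    unfolding e_def sum_divide_distrib[symmetric] by (subst sum.swap) simp
  have e_mult: "e (\<lambda>T. c * f T) = c * e f" for c f
    unfolding e_def by (simp add: sum_distrib_left[symmetric])
  have e_const: "e (\<lambda>T. c) = c" for c
    unfolding e_def using fin ne by simp
  define w :: "'n \<Rightarrow> 'n set \<Rightarrow> real" where "w = (\<lambda>i T. of_bool (i \<in> T))"
  have bij: "bij_betw ((`) (Transposition.transpose a b)) A A" for a b :: 'n
  proof (rule bij_betw_byWitness[where f' = "(`) (Transposition.transpose a b)"])
    show "\<forall>T\<in>A. Transposition.transpose a b ` Transposition.transpose a b ` T = T"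
      "\<forall>T\<in>A. Transposition.transpose a b ` Transposition.transpose a b ` T = T"
      by (simp_all add: image_comp)
  qed (auto simp: A_def card_image)
  have sym: "e (\<lambda>T. f (Transposition.transpose a b ` T)) = e f" for f and a b :: 'n
    unfolding e_def using sum.reindex_bij_betw[OF bij, of f a b] by simp
  have wt: "w i (Transposition.transpose a b ` T) = w (Transposition.transpose a b i) T" for i a b T
    unfolding w_def by (auto simp: image_iff) (metis transpose_involutory)
  define N where "N = real CARD('n)"
  define t where "t = real nT"
  have Nt: "0 < t" "t < N" "N > 1" "N \<noteq> 0" "t \<noteq> 0" "N - t \<noteq> 0" "N - 1 \<noteq> 0"
    using nT by (auto simp: N_def t_def)
  have sw: "(\<Sum>i\<in>UNIV. w i T) = t" if "card T = nT" for T
    using that by (simp add: w_def t_def)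
  have p: "e (w i) = t / N" for i
  proof -
    have same: "e (w l) = e (w i)" for l
      using sym[of "w i" i l] by (simp add: wt)
    have "(\<Sum>l\<in>UNIV. e (w l)) = (\<Sum>l\<in>(UNIV :: 'n set). e (w i))"
      by (rule sum.cong[OF refl]) (rule same)
    hence "(\<Sum>l\<in>UNIV. e (w l)) = N * e (w i)" by (simp add: N_def)
    moreover have "(\<Sum>l\<in>UNIV. e (w l)) = e (\<lambda>T. t)"
      unfolding e_sum[symmetric] by (rule e_cong) (simp add: sw)
    ultimately show ?thesis using Nt by (simp add: e_const field_simps)
  qed
  define q where "q = t * (t - 1) / (N * (N - 1))"
  have q: "e (\<lambda>T. w i T * w l T) = q" if "i \<noteq> l" for i l
  proof -
    have same: "e (\<lambda>T. w i T * w m T) = e (\<lambda>T. w i T * w l T)" if "m \<noteq> i" for m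
      using sym[of "\<lambda>T. w i T * w l T" l m] that \<open>i \<noteq> l\<close> by (simp add: wt)
    have "(\<Sum>m\<in>UNIV - {i}. e (\<lambda>T. w i T * w m T)) =
        (\<Sum>m\<in>UNIV - {i}. e (\<lambda>T. w i T * w l T))"
      by (rule sum.cong[OF refl]) (simp add: same)
    hence "(\<Sum>m\<in>UNIV - {i}. e (\<lambda>T. w i T * w m T)) = (N - 1) * e (\<lambda>T. w i T * w l T)"
      by (simp add: N_def card_Diff_singleton of_nat_diff)
    moreover have "(\<Sum>m\<in>UNIV - {i}. e (\<lambda>T. w i T * w m T)) = e (\<lambda>T. (t - 1) * w i T)"
      unfolding e_sum[symmetric]
    proof (rule e_cong)
      fix T :: "'n set" assume "card T = nT"
      have "(\<Sum>m\<in>UNIV - {i}. w i T * w m T) = w i T * (t - w i T)"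
        using sw[OF \<open>card T = nT\<close>]
        by (simp add: sum_distrib_left[symmetric] sum_diff1)
      also have "\<dots> = (t - 1) * w i T" by (simp add: w_def)
      finally show "(\<Sum>m\<in>UNIV - {i}. w i T * w m T) = (t - 1) * w i T" .
    qed
    ultimately have "(N - 1) * e (\<lambda>T. w i T * w l T) = (t - 1) * (t / N)"
      by (simp only: e_mult p)
    hence "e (\<lambda>T. w i T * w l T) = (t - 1) * (t / N) / (N - 1)"
      using Nt by (metis nonzero_mult_div_cancel_left)
    thus ?thesis by (simp add: q_def)
  qed
  have r: "e (\<lambda>T. w i T * w l T) = q + (if i = l then t / N - q else 0)" for i l
  proof (cases "i = l")
    case True
    have "(\<lambda>T. w l T * w l T) = w l" by (auto simp: w_def)
    thus ?thesis using True p by simp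
  qed (simp add: q)
  define c where "c = N / (t * (N - t))"
  let ?x = "\<lambda>i j. centered x $ i $ j"
  have D: "mean_diff x nT (\<chi> i. of_bool (i \<in> T)) $ j = c * (\<Sum>i\<in>UNIV. ?x i j * w i T)"
    if "card T = nT" for T j
    using mean_diff_centered[OF nT that] by (simp add: c_def N_def t_def w_def)
  have ED: "E (\<lambda>W. mean_diff x nT W $ j) = 0" for j
  proof -
    have "E (\<lambda>W. mean_diff x nT W $ j) = e (\<lambda>T. c * (\<Sum>i\<in>UNIV. ?x i j * w i T))"
      unfolding E by (rule e_cong) (rule D)
    also have "\<dots> = c * (t / N * (\<Sum>i\<in>UNIV. ?x i j))"
      by (simp only: e_mult e_sum p) (simp add: sum_distrib_left mult_ac)
    finally show ?thesis by (simp add: sum_centered)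
  qed
  have "E (\<lambda>W. mean_diff x nT W $ j * mean_diff x nT W $ k) =
      e (\<lambda>T. c^2 * (\<Sum>i\<in>UNIV. \<Sum>l\<in>UNIV. (?x i j * ?x l k) * (w i T * w l T)))"
    unfolding E by (rule e_cong)
      (simp add: D sum_product power2_eq_square mult_ac)
  also have "\<dots> = c^2 * (\<Sum>i\<in>UNIV. \<Sum>l\<in>UNIV. (?x i j * ?x l k) *
      (q + (if i = l then t / N - q else 0)))"
    by (simp only: e_mult e_sum r)
  also have "(\<Sum>i\<in>UNIV. \<Sum>l\<in>UNIV. (?x i j * ?x l k) * (q + (if i = l then t / N - q else 0)))
      = q * ((\<Sum>i\<in>UNIV. ?x i j) * (\<Sum>l\<in>UNIV. ?x l k)) + (t / N - q) * (\<Sum>i\<in>UNIV. ?x i j * ?x i k)"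
  proof -
    have "(?x i j * ?x l k) * (q + (if i = l then t / N - q else 0)) =
        q * (?x i j * ?x l k) + (if i = l then (t / N - q) * (?x i j * ?x i k) else 0)" for i l
      by (simp add: algebra_simps)
    thus ?thesis
      by (simp only: sum.distrib sum_product) (simp add: sum_distrib_left)
  qed
  also have "\<dots> = (t / N - q) * (\<Sum>i\<in>UNIV. ?x i j * ?x i k)"
    by (simp add: sum_centered)
  also have "c^2 * \<dots> = (c^2 * (t / N - q)) * (\<Sum>i\<in>UNIV. ?x i j * ?x i k)"
    by (rule mult.assoc[symmetric])
  also have "t / N - q = 1 / (c * (N - 1))"
    using Nt by (simp add: q_def c_def divide_simps) (simp add: algebra_simps)
  also have "c^2 * (1 / (c * (N - 1))) = c / (N - 1)"
    using Nt by (simp add: c_def power2_eq_square)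
  also have "c / (N - 1) * (\<Sum>i\<in>UNIV. ?x i j * ?x i k) = Sigma_mat x nT $ j $ k"
    by (simp add: Sigma_mat_def sample_cov_def c_def N_def t_def matrix_matrix_mult_def
        Finite_Cartesian_Product.transpose_def)
  finally show ?thesis by (simp add: ED)
qed

end

theory Submission
  imports Defs
begin

text \<open>
  By the spectral theorem \<open>\<Sigma> = Q diag(d) Q\<^sup>T\<close> with \<open>Q\<close> orthogonal.  Lebesgue measure is invariant
  under \<open>Q\<close>, so the rotated mean difference \<open>Y = Q\<^sup>T (mean difference)\<close> has a density that
  factors into the normal densities with variances \<open>d i\<close>, which is also the law of the vector with
  the coordinates \<open>sqrt (d i) * Z\<close>.  As \<open>\<Sigma> + l I = Q diag(d + l) Q\<^sup>T\<close>, the ridge distance equals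
  the sum of \<open>(Y i)\<^sup>2 / (d i + l)\<close>.  The \<open>d i\<close> are the roots of the characteristic polynomial
  with multiplicity, hence a permutation of the list of eigenvalues.
\<close>

section \<open>Spectral theorem\<close>

text \<open>For small \<open>t\<close> of the sign of \<open>a\<close> the linear term outweighs the
  quadratic one, and \<open>t = a / (\<bar>b\<bar> + 1)\<close> is small enough. This serves as the
  first-order condition at a maximum.\<close>

lemma linear_le_quadratic_imp_zero:
  fixes a b :: real
  assumes "\<And>t. 2 * t * a \<le> t\<^sup>2 * b"
  shows "a = 0"
proof (rule ccontr)
  assume "a \<noteq> 0"
  define c where "c = \<bar>b\<bar> + 1"
  have "c > 0" by (simp add: c_def)
  have "2 * (a / c) * a \<le> (a / c)\<^sup>2 * b" by (rule assms)
  hence "2 * a\<^sup>2 * c \<le> a\<^sup>2 * b"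
    using \<open>c > 0\<close> by (simp add: power2_eq_square field_simps)
  hence "2 * c \<le> b" using \<open>a \<noteq> 0\<close>
    by (metis mult.assoc mult.left_commute mult_le_cancel_left_pos zero_less_power2)
  thus False by (simp add: c_def)
qed

text \<open>The form \<open>v \<bullet> f v\<close> attains a maximum \<open>m\<close> on the
  compact unit sphere of \<open>V\<close>. A maximizer \<open>u\<close> is an eigenvector, because
  the first variation of the Rayleigh quotient along the residual \<open>f u - m u\<close> must
  vanish.\<close>

lemma self_adjoint_has_eigenvector:
  fixes f :: "'a::euclidean_space \<Rightarrow> 'a"
  assumes f: "linear f" and adj: "\<And>v w. f v \<bullet> w = v \<bullet> f w"
    and V: "subspace V" "f ` V \<subseteq> V" "V \<noteq> {0}"
  obtains u c where "u \<in> V" "norm u = 1" "f u = c *\<^sub>R u"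
proof -
  interpret f: linear f by (rule f)
  let ?K = "V \<inter> sphere 0 1"
  obtain v where v: "v \<in> V" "v \<noteq> 0"
    using V(1,3) subspace_0 by fastforce
  have "v /\<^sub>R norm v \<in> ?K"
    using v V(1) by (simp add: subspace_scale)
  hence ne: "?K \<noteq> {}" by blast
  have "compact ?K"
    using V(1) by (simp add: closed_Int_compact closed_subspace)
  moreover have "continuous_on ?K (\<lambda>v. v \<bullet> f v)"
    by (intro continuous_intros linear_continuous_on) (simp add: f linear_conv_bounded_linear[symmetric])
  ultimately obtain u where u: "u \<in> ?K" and max: "\<And>v. v \<in> ?K \<Longrightarrow> v \<bullet> f v \<le> u \<bullet> f u"
    using continuous_attains_sup[OF _ ne] by blast
  define m where "m = u \<bullet> f u"
  \<comment> \<open>Homogeneity extends the bound from the unit sphere to all of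
    \<open>V\<close>.\<close>
  have le: "v \<bullet> f v \<le> m * (v \<bullet> v)" if "v \<in> V" for v
  proof (cases "v = 0")
    case False
    have "v /\<^sub>R norm v \<in> ?K"
      using that False V(1) by (simp add: subspace_scale)
    from max[OF this] have "(v \<bullet> f v) / (norm v)\<^sup>2 \<le> m"
      by (simp add: f.scaleR m_def power2_eq_square divide_inverse mult_ac)
    thus ?thesis using False
      by (simp add: pos_divide_le_eq power2_norm_eq_inner)
  qed (simp add: f.zero)
  define w where "w = f u - m *\<^sub>R u"
  have uV: "u \<in> V" "u \<bullet> u = 1" using u by (auto simp: norm_eq_1)
  have wV: "w \<in> V"
    unfolding w_def using uV V by (intro subspace_diff subspace_scale) auto
  \<comment> \<open>This is \<open>le\<close> at \<open>u + t w\<close>, rearranged: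
    self-adjointness merges the cross terms, and the coefficient of \<open>2 * t\<close> becomes
    \<open>w \<bullet> f u - m * (w \<bullet> u)\<close>, which is
    \<open>w \<bullet> w\<close>.\<close>
  have "2 * t * (w \<bullet> w) \<le> t\<^sup>2 * (m * (w \<bullet> w) - w \<bullet> f w)" for t
  proof -
    have "u + t *\<^sub>R w \<in> V" using uV wV V(1) by (intro subspace_add subspace_scale)
    from le[OF this] have "m + 2 * t * (w \<bullet> f u) + t\<^sup>2 * (w \<bullet> f w)
        \<le> m + m * (2 * t * (w \<bullet> u)) + m * (t\<^sup>2 * (w \<bullet> w))"
      using adj[of u w]
      by (simp add: f.add f.scaleR inner_add_left inner_add_right uV m_def[symmetric]
          power2_eq_square inner_commute algebra_simps)
    moreover have "w \<bullet> w = w \<bullet> f u - m * (w \<bullet> u)"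
      by (simp add: w_def inner_diff_right inner_diff_left)
    hence "2 * t * (w \<bullet> w) = 2 * t * (w \<bullet> f u) - m * (2 * t * (w \<bullet> u))"
      by (simp add: right_diff_distrib)
    moreover have "t\<^sup>2 * (m * (w \<bullet> w) - w \<bullet> f w) = m * (t\<^sup>2 * (w \<bullet> w)) - t\<^sup>2 * (w \<bullet> f w)"
      by (simp add: right_diff_distrib)
    ultimately show ?thesis by linarith
  qed
  hence "w \<bullet> w = 0" by (rule linear_le_quadratic_imp_zero)
  hence "f u = m *\<^sub>R u" by (simp add: w_def)
  with uV show ?thesis by (intro that[of u m]) (auto simp: norm_eq_1)
qed

text \<open>Induction on the dimension: split off a unit eigenvector \<open>u\<close>. Its
  orthogonal complement within \<open>V\<close> has smaller dimension and is again invariant, since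
  \<open>u \<bullet> f v = c * (u \<bullet> v)\<close> by self-adjointness.\<close>

lemma self_adjoint_invariant_orthonormal_eigenbasis:
  fixes f :: "'a::euclidean_space \<Rightarrow> 'a"
  assumes f: "linear f" and adj: "\<And>v w. f v \<bullet> w = v \<bullet> f w"
  shows "subspace V \<Longrightarrow> f ` V \<subseteq> V \<Longrightarrow>
    \<exists>B. B \<subseteq> V \<and> span B = V \<and> pairwise orthogonal B \<and> (\<forall>b\<in>B. norm b = 1 \<and> (\<exists>c. f b = c *\<^sub>R b))"
proof (induction "dim V" arbitrary: V rule: less_induct)
  case less
  show ?case
  proof (cases "V = {0}")
    case True
    thus ?thesis by (intro exI[of _ "{}"]) auto
  next
    case False
    obtain u c where u: "u \<in> V" "norm u = 1" "f u = c *\<^sub>R u"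
      using self_adjoint_has_eigenvector[OF f adj less.prems False] by blast
    define U where "U = V \<inter> {v. orthogonal u v}"
    have U: "subspace U"
      unfolding U_def using less.prems(1) by (intro subspace_inter subspace_orthogonal_to_vector)
    have "f ` U \<subseteq> U"
    proof safe
      fix v assume v: "v \<in> U"
      have "u \<bullet> f v = c * (u \<bullet> v)" using adj[of u v] u(3) by simp
      with v show "f v \<in> U" using less.prems(2) by (auto simp: U_def orthogonal_def)
    qed
    moreover have "dim U < dim V"
    proof (rule dim_psubset)
      have "u \<notin> U" using u(2) by (auto simp: U_def orthogonal_def norm_eq_1)
      hence "U \<subset> V" using u(1) by (auto simp: U_def)
      thus "span U \<subset> span V" using U less.prems(1) by (simp add: span_eq_iff[THEN iffD2])
    qed
    ultimately obtain B where B: "B \<subseteq> U" "span B = U" "pairwise orthogonal B"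
        "\<And>b. b \<in> B \<Longrightarrow> norm b = 1 \<and> (\<exists>c. f b = c *\<^sub>R b)"
      using less.hyps[OF _ U] by meson
    \<comment> \<open>Subtracting from \<open>v\<close> its projection onto \<open>u\<close> leaves
      a vector of \<open>U\<close>, which is the span of \<open>B\<close>.\<close>
    have "v \<in> span (insert u B)" if "v \<in> V" for v
    proof -
      have "v - (u \<bullet> v) *\<^sub>R u \<in> U"
        using that u less.prems(1)
        by (auto simp: U_def orthogonal_def inner_diff_right norm_eq_1 intro!: subspace_diff subspace_scale)
      thus ?thesis using B(2) by (auto simp: span_insert)
    qed
    moreover have "insert u B \<subseteq> V" using u B(1) by (auto simp: U_def)
    ultimately have "span (insert u B) = V"
      using span_minimal less.prems(1) by blast
    moreover have "pairwise orthogonal (insert u B)"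
      using B(1,3) by (auto simp: pairwise_insert U_def orthogonal_commute)
    ultimately show ?thesis
      using u B(4) \<open>insert u B \<subseteq> V\<close> by (intro exI[of _ "insert u B"]) auto
  qed
qed

definition diag_mat :: "('k::finite \<Rightarrow> real) \<Rightarrow> real^'k^'k" where
  "diag_mat d = (\<chi> i j. if i = j then d i else 0)"

text \<open>An orthonormal eigenbasis supplies the columns of \<open>Q\<close>; the eigenvector
  equations then say that \<open>A ** Q\<close> is \<open>Q\<close> times a diagonal matrix.\<close>

lemma symmetric_matrix_orthogonal_diagonalization:
  fixes A :: "real^'k^'k"
  assumes sym: "transpose A = A"
  obtains Q d where "orthogonal_matrix Q" "A = Q ** diag_mat d ** transpose Q"
proof -
  have "\<exists>B. B \<subseteq> UNIV \<and> span B = UNIV \<and> pairwise orthogonal B \<and>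
      (\<forall>b\<in>B. norm b = 1 \<and> (\<exists>c. A *v b = c *\<^sub>R b))"
  proof (rule self_adjoint_invariant_orthonormal_eigenbasis)
    show "(A *v v) \<bullet> w = v \<bullet> (A *v w)" for v w
      by (metis dot_lmul_matrix sym transpose_matrix_vector)
  qed auto
  then obtain B where B: "span B = UNIV" "pairwise orthogonal B"
      "\<And>b. b \<in> B \<Longrightarrow> norm b = 1" "\<And>b. b \<in> B \<Longrightarrow> \<exists>c. A *v b = c *\<^sub>R b"
    by blast
  from B(4) obtain c where c: "\<And>b. b \<in> B \<Longrightarrow> A *v b = c b *\<^sub>R b" by metis
  \<comment> \<open>Unit norms exclude \<open>0\<close>, so orthogonality gives independence; the
    basis then has \<open>CARD('k)\<close> members and can be indexed by \<open>'k\<close>.\<close>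
  have "independent B"
    using B(2) B(3)[of 0] by (intro pairwise_orthogonal_independent) auto
  hence "finite B" "card B = CARD('k)"
    using B(1) dim_span_eq_card_independent[of B] independent_imp_finite[of B] by (simp_all add: dim_UNIV)
  then obtain b where b: "bij_betw b (UNIV :: 'k set) B"
    by (metis finite_class.finite_UNIV finite_same_card_bij)
  define Q :: "real^'k^'k" where "Q = (\<chi> i j. b j $ i)"
  have col: "column j Q = b j" for j by (simp add: Q_def column_def vec_eq_iff)
  have bB: "b j \<in> B" for j using b by (auto simp: bij_betw_def)
  have "inj b" using b by (auto simp: bij_betw_def)
  have Q: "orthogonal_matrix Q"
    unfolding orthogonal_matrix_orthonormal_columns col
    using B(2,3) bB \<open>inj b\<close> by (auto simp: pairwise_def inj_eq)
  let ?D = "diag_mat (\<lambda>i. c (b i))"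
  have "A ** Q = Q ** ?D"
  proof -
    have "(A ** Q) $ i $ j = (A *v b j) $ i" for i j
      by (simp add: matrix_matrix_mult_def matrix_vector_mult_def Q_def)
    thus ?thesis
      using c[OF bB] by (simp add: vec_eq_iff matrix_matrix_mult_def Q_def diag_mat_def mult_delta_right)
  qed
  hence "A = Q ** ?D ** transpose Q"
    using Q by (metis matrix_mul_assoc matrix_mul_rid orthogonal_matrix_def)
  with Q show ?thesis by (rule that)
qed

section \<open>Characteristic polynomial\<close>

text \<open>Allows matrix identities over the reals to be used over the polynomial ring, where the
  determinant defining \<open>charpoly\<close> is taken.\<close>

lemma matrix_mult_map_const_poly:
  fixes A B :: "real^'k^'k"
  shows "(\<chi> i j. [:A $ i $ j:]) ** (\<chi> i j. [:B $ i $ j:]) = (\<chi> i j. [:(A ** B) $ i $ j:])"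
  by (simp add: matrix_matrix_mult_def vec_eq_iff sum_to_poly mult.commute)

text \<open>Similarity invariance: \<open>X\<close> is the indeterminate times the identity and
  commutes with \<open>C Q\<close>, so conjugation by \<open>C Q\<close> takes
  \<open>X - C (diag_mat d)\<close> to the characteristic matrix of the product without changing the
  determinant.\<close>

lemma charpoly_orthogonal_conjugate_diagonal:
  fixes Q :: "real^'k^'k"
  assumes Q: "orthogonal_matrix Q"
  shows "charpoly (Q ** diag_mat d ** transpose Q) = (\<Prod>i\<in>UNIV. [:- d i, 1:])"
proof -
  define C :: "real^'k^'k \<Rightarrow> real poly^'k^'k" where "C A = (\<chi> i j. [:A $ i $ j:])" for A
  define X :: "real poly^'k^'k" where "X = (\<chi> i j. if i = j then [:0, 1:] else 0)"
  have charpoly: "charpoly A = det (X - C A)" for A :: "real^'k^'k"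
    by (simp add: charpoly_def X_def C_def minus_vec_def)
  have C_mult: "C A ** C B = C (A ** B)" for A B
    unfolding C_def by (rule matrix_mult_map_const_poly)
  have QQ: "C Q ** C (transpose Q) = mat 1"
    using Q by (simp add: C_mult orthogonal_matrix_def) (simp add: C_def mat_def vec_eq_iff pCons_one)
  have "C Q ** X = X ** C Q"
    by (simp add: matrix_matrix_mult_def X_def vec_eq_iff mult_delta_left mult_delta_right)
  hence "C Q ** X ** C (transpose Q) = X"
    using QQ by (metis matrix_mul_assoc matrix_mul_rid)
  moreover have "(A - B) ** M = A ** M - B ** M" "M ** (A - B) = M ** A - M ** B"
    for A B M :: "real poly^'k^'k"
    by (simp_all add: matrix_matrix_mult_def vec_eq_iff algebra_simps sum_subtractf)
  ultimately have "C Q ** (X - C (diag_mat d)) ** C (transpose Q) = X - C (Q ** diag_mat d ** transpose Q)"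
    by (simp add: C_mult)
  hence "charpoly (Q ** diag_mat d ** transpose Q) = det (C Q) * det (X - C (diag_mat d)) * det (C (transpose Q))"
    unfolding charpoly by (metis det_mul)
  also have "\<dots> = det (C Q ** C (transpose Q)) * det (X - C (diag_mat d))"
    by (simp add: det_mul mult_ac)
  also have "\<dots> = det (X - C (diag_mat d))" by (simp add: QQ)
  also have "\<dots> = (\<Prod>i\<in>UNIV. [:- d i, 1:])"
    by (subst det_diagonal) (auto simp: X_def C_def diag_mat_def)
  finally show ?thesis .
qed

text \<open>Each linear factor contributes its root \<open>d i\<close> once to
  \<open>proots\<close>, so repeated values keep their multiplicity; sorting and reversing do not
  affect the multiset.\<close>

lemma mset_eigenvalues_orthogonal_conjugate_diagonal:
  fixes Q :: "real^'k^'k"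
  assumes "orthogonal_matrix Q"
  shows "mset (eigenvalues (Q ** diag_mat d ** transpose Q)) = image_mset d (mset_set UNIV)"
proof -
  have "(\<Sum>i\<in>I. {#d i#}) = image_mset d (mset_set I)" for I :: "'k set"
    by (induction I rule: infinite_finite_induct) auto
  thus ?thesis
    by (simp add: eigenvalues_def charpoly_orthogonal_conjugate_diagonal[OF assms] proots_prod)
qed

text \<open>Matches the indices of \<open>d\<close> with positions of the list. Listing
  \<open>d\<close> along an enumeration \<open>g\<close> of \<open>I\<close> gives a list of which
  \<open>xs\<close> is a permutation by some \<open>p\<close>; the inverse of
  \<open>g \<circ> p\<close> is the required \<open>e\<close>.\<close>

lemma mset_eq_image_mset_bij:
  assumes "finite I" "mset xs = image_mset d (mset_set I)"
  obtains e where "bij_betw e I {..<length xs}" "\<And>i. i \<in> I \<Longrightarrow> xs ! e i = d i"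
proof -
  obtain g where g: "bij_betw g {..<card I} I"
    using assms(1) bij_betw_from_nat_into_finite by blast
  define ys where "ys = map (d \<circ> g) [0..<card I]"
  have len: "length ys = card I" by (simp add: ys_def)
  have "mset ys = image_mset d (image_mset g (mset_set {..<card I}))"
    by (simp add: ys_def image_mset.compositionality atLeast0LessThan)
  also have "image_mset g (mset_set {..<card I}) = mset_set I"
    using g by (simp add: bij_betw_def image_mset_mset_set)
  finally have "mset xs = mset ys" using assms(2) by simp
  then obtain p where p: "p permutes {..<length ys}" "permute_list p ys = xs"
    by (rule mset_eq_permutation)
  have lx: "length xs = card I" using p(2) len by auto
  have bij: "bij_betw (g \<circ> p) {..<length xs} I"
    using bij_betw_trans[OF permutes_imp_bij[OF p(1)] , of g I] g len lx by simp
  have nth: "xs ! j = d ((g \<circ> p) j)" if "j < length xs" for j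
    using that p lx len permutes_in_image[OF p(1), of j]
    by (auto simp: permute_list_nth ys_def)
  show ?thesis
  proof
    show "bij_betw (inv_into {..<length xs} (g \<circ> p)) I {..<length xs}"
      by (rule bij_betw_inv_into[OF bij])
    fix i assume "i \<in> I"
    thus "xs ! inv_into {..<length xs} (g \<circ> p) i = d i"
      using nth bij bij_betw_inv_into_right[OF bij] bij_betwE[OF bij_betw_inv_into[OF bij]] by fastforce
  qed
qed

section \<open>Laws of random vectors\<close>

text \<open>
  Both measures are translation invariant and agree on the unit ball \<open>B\<close>.  Evaluating the double
  integral of \<open>indicator A (f x) * indicator B (f x - y)\<close> in both orders shows that this
  determines them.
\<close>

lemma lborel_distr_orthogonal_transformation:
  fixes f :: "'a::euclidean_space \<Rightarrow> 'a"
  assumes f: "orthogonal_transformation f"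
  shows "distr lborel borel f = lborel"
proof (rule measure_eqI)
  have lin: "linear f" and norm: "\<And>v. norm (f v) = norm v"
    using f by (auto simp: orthogonal_transformation)
  interpret f: linear f by (rule lin)
  have [measurable]: "f \<in> borel_measurable borel"
    using lin by (intro borel_measurable_continuous_onI linear_continuous_on)
      (simp add: linear_conv_bounded_linear)
  have shift: "(\<integral>\<^sup>+x. h (c + x) \<partial>lborel) = (\<integral>\<^sup>+x. h x \<partial>lborel)"
    if [measurable]: "h \<in> borel_measurable borel" for h c
    by (subst lborel_distr_plus[of c, symmetric]) (simp add: nn_integral_distr)
  fix A :: "'a set" assume "A \<in> sets (distr lborel borel f)"
  hence A[measurable]: "A \<in> sets borel" by simp
  let ?B = "ball 0 1 :: 'a set"
  let ?b = "emeasure lborel ?B"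
  have [measurable]: "?B \<in> sets borel" by simp
  have b: "emeasure lborel (ball c 1) = ?b" for c :: 'a by (simp add: emeasure_ball)
  let ?I = "\<lambda>x y. indicator A (f x) * indicator ?B (f x - y) :: ennreal"
  have "(\<integral>\<^sup>+x. \<integral>\<^sup>+y. ?I x y \<partial>lborel \<partial>lborel) = (\<integral>\<^sup>+x. indicator A (f x) * ?b \<partial>lborel)"
  proof (rule nn_integral_cong)
    fix x
    have "indicator ?B (f x - y) = (indicator (ball (f x) 1) y :: ennreal)" for y
      by (simp add: indicator_def dist_norm norm_minus_commute)
    thus "(\<integral>\<^sup>+y. ?I x y \<partial>lborel) = indicator A (f x) * ?b"
      by (simp add: nn_integral_cmult_indicator b[of "f x"])
  qed
  also have "\<dots> = emeasure (distr lborel borel f) A * ?b"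
    using nn_integral_distr[of f lborel borel "indicator A"] by (simp add: nn_integral_multc)
  finally have *: "emeasure (distr lborel borel f) A * ?b = (\<integral>\<^sup>+x. \<integral>\<^sup>+y. ?I x y \<partial>lborel \<partial>lborel)" ..
  have "(\<integral>\<^sup>+x. \<integral>\<^sup>+y. ?I x y \<partial>lborel \<partial>lborel) = (\<integral>\<^sup>+y. \<integral>\<^sup>+x. ?I x y \<partial>lborel \<partial>lborel)"
    by (rule lborel_pair.Fubini') simp
  also have "\<dots> = (\<integral>\<^sup>+y. \<integral>\<^sup>+z. indicator A (y + f z) * indicator ?B (f z) \<partial>lborel \<partial>lborel)"
  proof (rule nn_integral_cong)
    fix y
    \<comment> \<open>With \<open>y = f c\<close>, shifting \<open>x\<close> by \<open>c\<close>
      turns \<open>f x\<close> into \<open>y + f x\<close> and cancels \<open>y\<close> inside the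
      ball indicator.\<close>
    obtain c where c: "f c = y"
      using orthogonal_transformation_surj[OF f] by (metis surj_def)
    show "(\<integral>\<^sup>+x. ?I x y \<partial>lborel) = (\<integral>\<^sup>+z. indicator A (y + f z) * indicator ?B (f z) \<partial>lborel)"
      using shift[of "\<lambda>x. ?I x y" c] by (simp add: f.add c)
  qed
  \<comment> \<open>As \<open>f\<close> preserves norms, \<open>f z\<close> lies in the unit ball
    exactly when \<open>z\<close> does. After the exchange of integrals, \<open>f z\<close> is a
    mere translation of \<open>y\<close>.\<close>
  also have "\<dots> = (\<integral>\<^sup>+z. \<integral>\<^sup>+y. indicator A (f z + y) * indicator ?B z \<partial>lborel \<partial>lborel)"
    by (subst lborel_pair.Fubini') (simp_all add: indicator_def norm add.commute)
  also have "\<dots> = (\<integral>\<^sup>+z. emeasure lborel A * indicator ?B z \<partial>lborel)"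
    by (intro nn_integral_cong, subst nn_integral_multc) (simp_all add: shift)
  also have "\<dots> = emeasure lborel A * ?b"
    by (simp add: nn_integral_cmult)
  finally have "emeasure (distr lborel borel f) A * ?b = emeasure lborel A * ?b"
    unfolding * .
  \<comment> \<open>The volume of the ball is positive and finite, so it can be cancelled in
    \<open>ennreal\<close>.\<close>
  moreover have "?b \<noteq> 0" "?b \<noteq> \<top>"
    using unit_ball_vol_pos[of "real DIM('a)", THEN less_imp_neq] by (auto simp: emeasure_ball)
  ultimately show "emeasure (distr lborel borel f) A = emeasure lborel A"
    by (metis ennreal_mult_cancel_left mult.commute)
qed simp

text \<open>No Jacobian factor arises: once \<open>lborel\<close> is written as its own image under
  \<open>f\<close>, pushing the density forward along the inverse \<open>g\<close> just composes
  \<open>p\<close> with \<open>f\<close>.\<close>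

lemma distributed_orthogonal_transformation:
  fixes X :: "'b \<Rightarrow> 'a::euclidean_space" and f g :: "'a \<Rightarrow> 'a"
  assumes X: "distributed M lborel X p" and f: "orthogonal_transformation f" and gf: "\<And>v. g (f v) = v"
    and fg: "\<And>v. f (g v) = v"
  shows "distributed M lborel (\<lambda>\<omega>. g (X \<omega>)) (\<lambda>v. p (f v))"
proof -
  have "linear f" using f by (simp add: orthogonal_transformation)
  hence [measurable]: "f \<in> borel_measurable borel"
    by (intro borel_measurable_continuous_onI linear_continuous_on)
      (simp add: linear_conv_bounded_linear)
  have "g = inv f" using gf fg by (metis inv_equality ext)
  hence "linear g"
    using orthogonal_transformation_inv[OF f] by (simp add: orthogonal_transformation)
  hence [measurable]: "g \<in> borel_measurable borel"
    by (intro borel_measurable_continuous_onI linear_continuous_on)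
      (simp add: linear_conv_bounded_linear)
  have [measurable]: "X \<in> borel_measurable M" "p \<in> borel_measurable borel"
    using X by (simp_all add: distributed_def)
  have "distr M lborel (\<lambda>\<omega>. g (X \<omega>)) = distr (distr M lborel X) lborel g"
    by (subst distr_distr) (simp_all add: comp_def)
  also have "distr M lborel X = density (distr lborel borel f) p"
    using X by (simp add: distributed_def lborel_distr_orthogonal_transformation[OF f])
  also have "distr \<dots> lborel g = density lborel (p \<circ> f)"
    by (rule distr_density_distr) (simp_all add: gf)
  finally show ?thesis by (simp add: distributed_def comp_def)
qed

text \<open>A product measure is determined by its values on boxes. There the integrand factors over
  the coordinates, and the integral becomes a product of integrals.\<close>

lemma PiM_density:
  assumes "finite I" "product_sigma_finite M" "product_sigma_finite (\<lambda>i. density (M i) (f i))"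
    and [measurable]: "\<And>i. i \<in> I \<Longrightarrow> f i \<in> borel_measurable (M i)"
  shows "PiM I (\<lambda>i. density (M i) (f i)) = density (PiM I M) (\<lambda>x. \<Prod>i\<in>I. f i (x i))"
proof -
  interpret M: product_sigma_finite M by fact
  interpret D: product_sigma_finite "\<lambda>i. density (M i) (f i)" by fact
  note [simp] = \<open>finite I\<close>
  show ?thesis
  proof (rule D.PiM_eqI[symmetric])
    fix A assume "\<And>i. i \<in> I \<Longrightarrow> A i \<in> sets (density (M i) (f i))"
    hence [measurable]: "\<And>i. i \<in> I \<Longrightarrow> A i \<in> sets (M i)" by simp
    have "emeasure (density (PiM I M) (\<lambda>x. \<Prod>i\<in>I. f i (x i))) (PiE I A) =
        (\<integral>\<^sup>+x. (\<Prod>i\<in>I. f i (x i)) * indicator (PiE I A) x \<partial>PiM I M)"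
      by (intro emeasure_density) auto
    also have "\<dots> = (\<integral>\<^sup>+x. (\<Prod>i\<in>I. f i (x i) * indicator (A i) (x i)) \<partial>PiM I M)"
    proof (rule nn_integral_cong)
      fix x assume "x \<in> space (PiM I M)"
      \<comment> \<open>For extensional points, membership in the box depends only on the
        coordinates in \<open>I\<close>, so its indicator factors.\<close>
      hence "x \<in> extensional I" by (auto simp: space_PiM PiE_def)
      hence "(indicator (PiE I A) x :: ennreal) = (\<Prod>i\<in>I. indicator (A i) (x i))"
        by (auto simp: indicator_def PiE_iff prod_zero_iff)
      thus "(\<Prod>i\<in>I. f i (x i)) * indicator (PiE I A) x = (\<Prod>i\<in>I. f i (x i) * indicator (A i) (x i))"
        by (simp add: prod.distrib)
    qed
    also have "\<dots> = (\<Prod>i\<in>I. \<integral>\<^sup>+x. f i x * indicator (A i) x \<partial>M i)"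
      by (rule M.product_nn_integral_prod) auto
    also have "\<dots> = (\<Prod>i\<in>I. emeasure (density (M i) (f i)) (A i))"
      by (intro prod.cong refl) (simp add: emeasure_density)
    finally show "emeasure (density (PiM I M) (\<lambda>x. \<Prod>i\<in>I. f i (x i))) (PiE I A) =
        (\<Prod>i\<in>I. emeasure (density (M i) (f i)) (A i))" .
  qed (simp_all cong: sets_PiM_cong)
qed

text \<open>Independence makes the joint law a product of the marginal laws, whose densities
  multiply. \<open>lborel\<close> itself is the image of the product of real Lebesgue measures under
  the map \<open>?s\<close> that assembles a vector from its coordinates.\<close>

lemma distributed_indep_coordinates:
  fixes X :: "'a::euclidean_space \<Rightarrow> 'z \<Rightarrow> real"
  assumes P: "prob_space P" and indep: "prob_space.indep_vars P (\<lambda>_. borel) X Basis"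
    and dens: "\<And>b. b \<in> Basis \<Longrightarrow> distributed P lborel (X b) (f b)"
  shows "distributed P lborel (\<lambda>\<omega>. \<Sum>b\<in>Basis. X b \<omega> *\<^sub>R b) (\<lambda>x. \<Prod>b\<in>Basis. f b (x \<bullet> b))"
proof -
  interpret prob_space P by (rule P)
  \<comment> \<open>\<open>product_sigma_finite\<close> concerns every index of the type, whereas
    \<open>f\<close> is controlled only on \<open>Basis\<close>; the default density
    \<open>1\<close> leaves \<open>lborel\<close> elsewhere.\<close>
  define h where "h b = (if b \<in> Basis then f b else (\<lambda>_. 1))" for b
  have X[measurable]: "b \<in> Basis \<Longrightarrow> X b \<in> borel_measurable P" for b
    using dens[of b] by (simp add: distributed_def)
  have f[measurable]: "b \<in> Basis \<Longrightarrow> f b \<in> borel_measurable borel" for b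
    using dens[of b] by (simp add: distributed_def)
  have h[measurable]: "h b \<in> borel_measurable borel" for b
    by (auto simp: h_def)
  have law: "distr P borel (X b) = density lborel (h b)" if "b \<in> Basis" for b
    using dens[OF that] that by (simp add: distributed_def h_def cong: distr_cong)
  have sf: "product_sigma_finite (\<lambda>b. density lborel (h b))"
  proof (rule product_sigma_finite.intro)
    fix b
    show "sigma_finite_measure (density lborel (h b))"
    proof (cases "b \<in> Basis")
      case True
      thus ?thesis unfolding law[OF True, symmetric]
        by (intro prob_space_imp_sigma_finite prob_space_distr) auto
    next
      case False
      thus ?thesis using lborel.sigma_finite_measure_axioms by (simp add: h_def density_1)
    qed
  qed
  have sf': "product_sigma_finite (\<lambda>_::'a. lborel :: real measure)"
    by standard
  let ?s = "\<lambda>y. \<Sum>b\<in>Basis. y b *\<^sub>R b :: 'a"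
  have s[measurable]: "?s \<in> measurable (\<Pi>\<^sub>M b\<in>Basis. borel) borel" by measurable
  have "distr P lborel (\<lambda>\<omega>. \<Sum>b\<in>Basis. X b \<omega> *\<^sub>R b) =
      distr (distr P (\<Pi>\<^sub>M b\<in>Basis. borel) (\<lambda>\<omega>. \<lambda>b\<in>Basis. X b \<omega>)) borel ?s"
    by (subst distr_distr) (auto simp: comp_def intro!: distr_cong)
  also have "distr P (\<Pi>\<^sub>M b\<in>Basis. borel) (\<lambda>\<omega>. \<lambda>b\<in>Basis. X b \<omega>) = (\<Pi>\<^sub>M b\<in>Basis. distr P borel (X b))"
    using indep by (subst (asm) indep_vars_iff_distr_eq_PiM') auto
  also have "\<dots> = (\<Pi>\<^sub>M b\<in>Basis. density lborel (h b))"
    by (rule PiM_cong) (auto simp: law)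
  also have "\<dots> = density (\<Pi>\<^sub>M b\<in>Basis. lborel) (\<lambda>x. \<Prod>b\<in>Basis. h b (x b))"
    by (rule PiM_density) (auto simp: sf sf')
  also have "distr \<dots> borel ?s = density (distr (\<Pi>\<^sub>M b\<in>Basis. lborel) borel ?s) (\<lambda>x. \<Prod>b\<in>Basis. h b (x \<bullet> b))"
    by (subst density_distr) (auto simp: inner_sum_left inner_Basis if_distrib cong: if_cong)
  also have "distr (\<Pi>\<^sub>M b\<in>Basis. lborel) borel ?s = lborel"
    by (rule lborel_eq[symmetric])
  finally show ?thesis
    by (auto simp: distributed_def h_def)
qed

text \<open>Injectivity of \<open>f\<close> makes the singleton blocks \<open>{f j}\<close>
  disjoint, and functions of disjoint blocks of independent variables are independent.\<close>

lemma (in prob_space) indep_vars_reindex_compose: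
  assumes X: "indep_vars M' X I" and f: "inj_on f L" "f ` L \<subseteq> I"
    and Y: "\<And>j. j \<in> L \<Longrightarrow> Y j \<in> measurable (M' (f j)) (N j)"
  shows "indep_vars N (\<lambda>j \<omega>. Y j (X (f j) \<omega>)) L"
proof -
  have "indep_vars (\<lambda>j. PiM {f j} M') (\<lambda>j \<omega>. \<lambda>i\<in>{f j}. X i \<omega>) L"
    using f by (intro indep_vars_restrict[OF X]) (auto simp: disjoint_family_on_def inj_on_def)
  hence "indep_vars N (\<lambda>j \<omega>. Y j ((\<lambda>i\<in>{f j}. X i \<omega>) (f j))) L"
    by (rule indep_vars_compose2[where Y = "\<lambda>j g. Y j (g (f j))"])
      (auto intro!: measurable_compose[OF _ Y] measurable_component_singleton)
  thus ?thesis by simp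
qed

lemma sum_Basis_vec: "(\<Sum>b\<in>(Basis :: (real^'k) set). g b) = (\<Sum>i\<in>UNIV. g (axis i 1))"
  by (simp add: Basis_vec_def UNION_singleton_eq_range sum.reindex axis_eq_axis inj_on_def)

lemma prod_Basis_vec: "(\<Prod>b\<in>(Basis :: (real^'k) set). g b) = (\<Prod>i\<in>UNIV. g (axis i 1))"
  by (simp add: Basis_vec_def UNION_singleton_eq_range prod.reindex axis_eq_axis inj_on_def)

text \<open>\<open>Basis\<close> consists of the vectors \<open>axis i 1\<close>, so
  \<open>axis_index\<close> turns the family over \<open>'k\<close> into one over
  \<open>Basis\<close>.\<close>

lemma distributed_indep_vec:
  fixes X :: "'k::finite \<Rightarrow> 'z \<Rightarrow> real"
  assumes P: "prob_space P" and indep: "prob_space.indep_vars P (\<lambda>_. borel) X UNIV"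
    and dens: "\<And>i. distributed P lborel (X i) (f i)"
  shows "distributed P lborel (\<lambda>\<omega>. \<chi> i. X i \<omega>) (\<lambda>v. \<Prod>i\<in>UNIV. f i (v $ i))"
proof -
  interpret prob_space P by (rule P)
  have "inj_on axis_index (Basis :: (real^'k) set)"
    by (metis axis_index inj_onI)
  hence "indep_vars (\<lambda>_. borel) (\<lambda>b. X (axis_index b)) (Basis :: (real^'k) set)"
    using indep_vars_reindex_compose[OF indep, of axis_index Basis "\<lambda>_ x. x" "\<lambda>_. borel"] by simp
  from distributed_indep_coordinates[OF P this dens]
  have "distributed P lborel (\<lambda>\<omega>. \<Sum>i\<in>UNIV. X i \<omega> *\<^sub>R axis i 1 :: real^'k)
      (\<lambda>v. \<Prod>i\<in>UNIV. f i (v $ i))"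
    by (simp add: sum_Basis_vec prod_Basis_vec inner_axis)
  moreover have "(\<Sum>i\<in>UNIV. X i \<omega> *\<^sub>R axis i 1 :: real^'k) = (\<chi> i. X i \<omega>)" for \<omega>
    using basis_expansion[of "\<chi> i. X i \<omega>"] by (simp add: scalar_mult_eq_scaleR)
  ultimately show ?thesis by simp
qed

section \<open>Normal law with diagonalized covariance\<close>

lemma diag_mat_mult: "diag_mat a ** diag_mat b = diag_mat (\<lambda>i. a i * b i)"
  by (simp add: diag_mat_def matrix_matrix_mult_def vec_eq_iff mult_delta_left mult_delta_right)

lemma diag_mat_vector_mult: "(diag_mat d *v v) $ i = d i * v $ i"
  by (simp add: diag_mat_def matrix_vector_mult_def mult_delta_left)

text \<open>The ridge term is itself \<open>c\<close> times \<open>Q ** transpose Q\<close>, so it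
  only shifts the diagonal entries.\<close>

lemma orthogonal_conjugate_diagonal_add_scaled_mat:
  fixes Q :: "real^'k^'k"
  assumes "orthogonal_matrix Q"
  shows "Q ** diag_mat d ** transpose Q + c *\<^sub>R mat 1 = Q ** diag_mat (\<lambda>i. d i + c) ** transpose Q"
proof -
  have "Q ** diag_mat (\<lambda>i. d i + c) = Q ** diag_mat d + c *\<^sub>R Q"
    by (simp add: diag_mat_def matrix_matrix_mult_def vec_eq_iff mult_delta_right algebra_simps)
  moreover have "(Q ** diag_mat d + c *\<^sub>R Q) ** transpose Q = Q ** diag_mat d ** transpose Q + c *\<^sub>R (Q ** transpose Q)"
    by (simp add: matrix_matrix_mult_def[of _ "transpose Q"] vec_eq_iff algebra_simps sum.distrib sum_distrib_left)
  ultimately show ?thesis using assms by (simp add: orthogonal_matrix_def)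
qed

text \<open>A one-sided inverse of a square matrix is two-sided. It witnesses the choice in
  \<open>matrix_inv_def\<close>, and two-sided inverses are unique.\<close>

lemma matrix_inv_eqI:
  fixes A B :: "real^'k^'k"
  assumes "A ** B = mat 1"
  shows "matrix_inv A = B"
proof -
  have BA: "B ** A = mat 1" using assms by (simp add: matrix_left_right_inverse)
  have "A ** matrix_inv A = mat 1 \<and> matrix_inv A ** A = mat 1"
    unfolding matrix_inv_def by (rule someI[of _ B]) (simp add: assms BA)
  thus ?thesis using BA by (metis matrix_mul_assoc matrix_mul_lid matrix_mul_rid)
qed

lemma matrix_inv_orthogonal_conjugate_diagonal:
  fixes Q :: "real^'k^'k"
  assumes Q: "orthogonal_matrix Q" and d: "\<And>i. d i \<noteq> 0"
  shows "matrix_inv (Q ** diag_mat d ** transpose Q) = Q ** diag_mat (\<lambda>i. 1 / d i) ** transpose Q"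
proof (rule matrix_inv_eqI)
  have "transpose Q ** Q = mat 1" "Q ** transpose Q = mat 1"
    using Q by (simp_all add: orthogonal_matrix_def)
  moreover have "diag_mat d ** diag_mat (\<lambda>i. 1 / d i) = mat 1"
    using d by (simp add: diag_mat_mult) (simp add: diag_mat_def mat_def)
  ultimately show "Q ** diag_mat d ** transpose Q ** (Q ** diag_mat (\<lambda>i. 1 / d i) ** transpose Q) = mat 1"
    by (metis matrix_mul_assoc matrix_mul_rid)
qed

text \<open>Moving \<open>Q\<close> to the other argument as its transpose leaves a diagonal form in
  the coordinates of \<open>transpose Q *v v\<close>.\<close>

lemma inner_orthogonal_conjugate_diagonal:
  fixes Q :: "real^'k^'k"
  shows "v \<bullet> ((Q ** diag_mat e ** transpose Q) *v v) = (\<Sum>i\<in>UNIV. e i * ((transpose Q *v v) $ i)\<^sup>2)"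
proof -
  have adj: "v \<bullet> (Q *v w) = (transpose Q *v v) \<bullet> w" for w
    by (simp add: dot_lmul_matrix)
  have "v \<bullet> ((Q ** diag_mat e ** transpose Q) *v v) =
      (transpose Q *v v) \<bullet> (diag_mat e *v (transpose Q *v v))"
    unfolding adj[symmetric] by (simp add: matrix_vector_mul_assoc matrix_mul_assoc del: transpose_matrix_vector)
  also have "\<dots> = (\<Sum>i\<in>UNIV. e i * ((transpose Q *v v) $ i)\<^sup>2)"
    by (simp only: inner_vec_def diag_mat_vector_mult) (simp add: power2_eq_square mult_ac)
  finally show ?thesis .
qed

text \<open>The quadratic form takes the value \<open>d i\<close> at the \<open>i\<close>-th column
  of \<open>Q\<close>, which is nonzero.\<close>

lemma positive_definite_orthogonal_conjugate_diagonal: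
  fixes Q :: "real^'k^'k"
  assumes Q: "orthogonal_matrix Q" and pos: "positive_definite (Q ** diag_mat d ** transpose Q)"
  shows "d i > 0"
proof -
  have QQ: "transpose Q ** Q = mat 1" using Q by (simp add: orthogonal_matrix_def)
  define v where "v = Q *v axis i 1"
  have v: "transpose Q *v v = axis i 1"
    by (simp add: v_def matrix_vector_mul_assoc QQ)
  hence "v \<noteq> 0" by (metis axis_eq_0_iff matrix_vector_mult_0_right zero_neq_one)
  hence "0 < v \<bullet> ((Q ** diag_mat d ** transpose Q) *v v)"
    using pos by (simp add: positive_definite_def)
  also have "\<dots> = d i"
    by (simp add: inner_orthogonal_conjugate_diagonal v axis_def power2_eq_square mult_delta_left mult_delta_right del: transpose_matrix_vector)
  finally show ?thesis .
qed

text \<open>The determinant is the product of the \<open>d i\<close> and the exponent is a sum over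
  coordinates, so the density factors. \<open>normal_density\<close> takes a standard deviation,
  hence \<open>sqrt (d i)\<close>.\<close>

lemma mv_normal_density_orthogonal_conjugate_diagonal:
  fixes Q :: "real^'k^'k"
  assumes Q: "orthogonal_matrix Q" and d: "\<And>i. d i > 0"
  shows "mv_normal_density 0 (Q ** diag_mat d ** transpose Q) (Q *v y) =
    (\<Prod>i\<in>UNIV. normal_density 0 (sqrt (d i)) (y $ i))"
proof -
  have QQ: "transpose Q ** Q = mat 1" using Q by (simp add: orthogonal_matrix_def)
  have "det (Q ** diag_mat d ** transpose Q) = (det Q)\<^sup>2 * (\<Prod>i\<in>UNIV. d i)"
    by (simp add: det_mul det_diagonal diag_mat_def power2_eq_square)
  also have "(det Q)\<^sup>2 = 1" using det_orthogonal_matrix[OF Q] by auto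
  finally have det: "det (Q ** diag_mat d ** transpose Q) = (\<Prod>i\<in>UNIV. d i)" by simp
  have sqrt_prod: "sqrt (prod f I) = (\<Prod>i\<in>I. sqrt (f i))" for f and I :: "'k set"
    by (induction I rule: infinite_finite_induct) (simp_all add: real_sqrt_mult)
  have d0: "d i \<noteq> 0" for i using d[of i] by simp
  have "(Q *v y) \<bullet> (matrix_inv (Q ** diag_mat d ** transpose Q) *v (Q *v y)) = (\<Sum>i\<in>UNIV. (y $ i)\<^sup>2 / d i)"
    by (simp only: matrix_inv_orthogonal_conjugate_diagonal[OF Q d0] inner_orthogonal_conjugate_diagonal)
      (simp add: matrix_vector_mul_assoc QQ del: transpose_matrix_vector)
  \<comment> \<open>The power \<open>(2 * pi) ^ CARD('k)\<close> supplies one factor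
    \<open>2 * pi\<close> to each coordinate.\<close>
  hence "mv_normal_density 0 (Q ** diag_mat d ** transpose Q) (Q *v y) =
      1 / sqrt (\<Prod>i\<in>(UNIV::'k set). 2 * pi * d i) * exp (\<Sum>i\<in>UNIV. - (y $ i)\<^sup>2 / (2 * d i))"
    by (simp add: mv_normal_density_def det prod.distrib sum_negf sum_divide_distrib mult.commute)
  also have "\<dots> = (\<Prod>i\<in>UNIV. 1 / sqrt (2 * pi * d i) * exp (- (y $ i)\<^sup>2 / (2 * d i)))"
    by (simp only: sqrt_prod exp_sum[OF finite_class.finite_UNIV] prod_dividef prod.neutral_const
        prod.distrib[of "\<lambda>i. 1 / sqrt (2 * pi * d i)"])
  also have "\<dots> = (\<Prod>i\<in>UNIV. normal_density 0 (sqrt (d i)) (y $ i))"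
    using d by (intro prod.cong refl) (simp add: normal_density_def less_imp_le)
  finally show ?thesis .
qed

section \<open>Law of the ridge Mahalanobis distance\<close>

theorem lemma4p1:
  fixes x :: "real^'k^'n" and nT :: nat and l :: real
    and M :: "'w measure" and W :: "'w \<Rightarrow> real^'n"
    and P :: "'z measure" and Z :: "nat \<Rightarrow> 'z \<Rightarrow> real"
  assumes "0 < nT" and "nT < CARD('n)"
    and "positive_definite (Sigma_mat x nT)"
    and "l \<ge> 0"
    and "prob_space M" and "W \<in> borel_measurable M"
    and "distributed M lborel (\<lambda>\<omega>. mean_diff x nT (W \<omega>)) (mv_normal_density 0 (Sigma_mat x nT))"
    and "prob_space P"
    and "prob_space.indep_vars P (\<lambda>_. borel) Z {..<CARD('k)}"
    and "\<And>j. j < CARD('k) \<Longrightarrow> distributed P lborel (Z j) std_normal_density"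
  shows "length (eigenvalues (Sigma_mat x nT)) = CARD('k)
    \<and> sorted_wrt (\<ge>) (eigenvalues (Sigma_mat x nT))
    \<and> (\<forall>t \<in> set (eigenvalues (Sigma_mat x nT)). t > 0)
    \<and> distr M borel (\<lambda>\<omega>. ridge_mahalanobis x nT l (W \<omega>)) =
      distr P borel (\<lambda>\<omega>. \<Sum>j<CARD('k).
        eigenvalues (Sigma_mat x nT) ! j / (eigenvalues (Sigma_mat x nT) ! j + l) * (Z j \<omega>)\<^sup>2)"
proof -
  let ?S = "Sigma_mat x nT" and ?K = "CARD('k)"
  interpret M: prob_space M by fact
  interpret P: prob_space P by fact
  have "transpose ?S = ?S" using assms(3) by (simp add: positive_definite_def)
  then obtain Q d where Q: "orthogonal_matrix Q" and S: "?S = Q ** diag_mat d ** transpose Q"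
    by (rule symmetric_matrix_orthogonal_diagonalization)
  have QQ: "transpose Q ** Q = mat 1" "Q ** transpose Q = mat 1"
    using Q by (simp_all add: orthogonal_matrix_def)
  have d: "d i > 0" for i
    using positive_definite_orthogonal_conjugate_diagonal[OF Q] assms(3) unfolding S by blast
  have mset: "mset (eigenvalues ?S) = image_mset d (mset_set UNIV)"
    unfolding S by (rule mset_eigenvalues_orthogonal_conjugate_diagonal[OF Q])
  have length: "length (eigenvalues ?S) = ?K"
    using arg_cong[OF mset, of size] by simp
  have sorted: "sorted_wrt (\<ge>) (eigenvalues ?S)"
    by (simp add: eigenvalues_def sorted_wrt_rev)
  have pos: "\<forall>t\<in>set (eigenvalues ?S). t > 0"
    using arg_cong[OF mset, of set_mset] d by auto
  \<comment> \<open>The diagonal \<open>d\<close> comes in no particular order; \<open>e\<close>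
    sends each index to a position of its value in the sorted list.\<close>
  obtain e where e: "bij_betw e (UNIV :: 'k set) {..<?K}" and nth: "\<And>i. eigenvalues ?S ! e i = d i"
    using mset_eq_image_mset_bij[OF finite_class.finite_UNIV mset] length by auto

  define D where "D = (\<lambda>\<omega>. mean_diff x nT (W \<omega>))"
  define Y where "Y = (\<lambda>\<omega>. transpose Q *v D \<omega>)"
  \<comment> \<open>Each coordinate uses the normal variable at the position of its eigenvalue.
    \<open>Y\<close> and \<open>U\<close> will share the density \<open>p\<close>, and
    \<open>h\<close> expresses both sides of the claim through them.\<close>
  define U where "U = (\<lambda>\<omega>. (\<chi> i. sqrt (d i) * Z (e i) \<omega>))"
  define h where "h y = (\<Sum>i\<in>UNIV. 1 / (d i + l) * (y $ i)\<^sup>2)" for y :: "real^'k"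
  define p where "p y = (\<Prod>i\<in>UNIV. ennreal (normal_density 0 (sqrt (d i)) (y $ i)))" for y :: "real^'k"
  have [measurable]: "h \<in> borel_measurable borel" unfolding h_def by measurable

  have "distributed M lborel Y (\<lambda>y. ennreal (mv_normal_density 0 ?S (Q *v y)))"
    unfolding Y_def
  proof (rule distributed_orthogonal_transformation[where X = D and f = "(*v) Q"
        and p = "\<lambda>v. ennreal (mv_normal_density 0 ?S v)"])
    show "distributed M lborel D (\<lambda>v. ennreal (mv_normal_density 0 ?S v))"
      unfolding D_def by (rule assms(7))
    show "orthogonal_transformation ((*v) Q)"
      using Q by (simp add: orthogonal_transformation_matrix)
  qed (simp_all add: matrix_vector_mul_assoc QQ del: transpose_matrix_vector)
  moreover have "ennreal (mv_normal_density 0 ?S (Q *v y)) = p y" for y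
    unfolding S mv_normal_density_orthogonal_conjugate_diagonal[OF Q d] p_def
    by (simp add: prod_ennreal)
  ultimately have Y: "distributed M lborel Y p" by simp

  have "e i < ?K" for i using e by (auto simp: bij_betw_def)
  have U: "distributed P lborel U p"
    unfolding U_def p_def
  proof (rule distributed_indep_vec)
    show "P.indep_vars (\<lambda>_. borel) (\<lambda>i \<omega>. sqrt (d i) * Z (e i) \<omega>) UNIV"
      using e by (intro P.indep_vars_reindex_compose[OF assms(9), where Y = "\<lambda>i z. sqrt (d i) * z"])
        (auto simp: bij_betw_def)
    show "distributed P lborel (\<lambda>\<omega>. sqrt (d i) * Z (e i) \<omega>)
        (\<lambda>y. ennreal (normal_density 0 (sqrt (d i)) y))" for i
      using P.normal_density_affine[OF assms(10)[OF \<open>e i < ?K\<close>], of "sqrt (d i)" 0] d[of i]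
      by simp
  qed fact

  have hY: "ridge_mahalanobis x nT l (W \<omega>) = h (Y \<omega>)" for \<omega>
  proof -
    \<comment> \<open>From \<open>d i > 0\<close> and \<open>l \<ge> 0\<close>; this makes the
      shifted diagonal invertible.\<close>
    have "d i + l \<noteq> 0" for i using d[of i] assms(4) by simp
    thus ?thesis
      unfolding ridge_mahalanobis_def S
        orthogonal_conjugate_diagonal_add_scaled_mat[OF Q]
      by (simp add: matrix_inv_orthogonal_conjugate_diagonal[OF Q] inner_orthogonal_conjugate_diagonal
          h_def Y_def D_def del: transpose_matrix_vector)
  qed
  \<comment> \<open>Squaring \<open>sqrt (d i)\<close> turns the weight \<open>1 / (d i + l)\<close>
    of \<open>h\<close> into \<open>d i / (d i + l)\<close>, and \<open>e\<close> reindexes the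
    sum.\<close>
  have hU: "(\<Sum>j<?K. eigenvalues ?S ! j / (eigenvalues ?S ! j + l) * (Z j \<omega>)\<^sup>2) = h (U \<omega>)" for \<omega>
    using sum.reindex_bij_betw[OF e, of "\<lambda>j. eigenvalues ?S ! j / (eigenvalues ?S ! j + l) * (Z j \<omega>)\<^sup>2"] d
    by (simp add: nth h_def U_def power_mult_distrib less_imp_le)
  \<comment> \<open>The law of \<open>h (V \<omega>)\<close> depends on \<open>V\<close> only
    through its density, so variables on different probability spaces can be compared.\<close>
  have law: "distr N borel (\<lambda>\<omega>. h (V \<omega>)) = distr (density lborel p) borel h"
    if "distributed N lborel V p" for N :: "'b measure" and V
    using that distr_distr[of h lborel borel V N] by (simp add: distributed_def comp_def)
  have "distr M borel (\<lambda>\<omega>. ridge_mahalanobis x nT l (W \<omega>)) =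
      distr P borel (\<lambda>\<omega>. \<Sum>j<?K. eigenvalues ?S ! j / (eigenvalues ?S ! j + l) * (Z j \<omega>)\<^sup>2)"
    unfolding hY hU law[OF Y] law[OF U] ..
  with length sorted pos show ?thesis by blast
qed

end
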